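(* For $(a,s,p)\in\mathbb{C}^3$, the following are equivalent: (1) $(a,s,p)\in b\mathcal{P}$, the distinguished boundary of the pentablock $\mathcal{P}$; (2) there exists a unique unitary matrix $U=\begin{pmatrix} u_{11} & u_{12} \\ u_{21} & u_{22} \end{pmatrix}\in M_2(\mathbb{C})$ such that $u_{11}=u_{22}$ and $(a,s,p)=(u_{21},\operatorname{tr}(U),\det(U))$.
   Context: The pentablock is $\mathcal{P}=\{(a_{21},\operatorname{tr}(A),\det(A)) : A=[a_{ij}]\in M_2(\mathbb{C}),\ \|A\|<1\}\subset\mathbb{C}^3$, where $\|\cdot\|$ is the operator norm. For a bounded polynomially convex domain $\Omega\subset\mathbb{C}^d$, let $A(\Omega)$ be the algebra of continuous scalar functions on $\overline{\Omega}$ that are holomorphic in $\Omega$. A boundary for $\Omega$ is a subset $C\subset\overline{\Omega}$ such that every function in $A(\Omega)$ attains its maximum modulus on $C$. The distinguished boundary $b\Omega$ is the smallest closed boundary of $\Omega$. It is known (Agler, Lykova and Young) that $b\mathcal{P}=\{(a,s,p)\in\mathbb{C}^3: |s|\le 2,\ s=\overline{s}p,\ |p|=1,\ |a|=\sqrt{1-\tfrac14|s|^2}\}$. *)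

theory Defs
  imports "HOL-Analysis.Analysis"
begin

text \<open>
  Complex \<open>d\<close>-space is \<^typ>\<open>complex^'n\<close>. Its norm is the Euclidean norm, so
  \<^term>\<open>onorm ((*v) A)\<close> is the operator norm of a complex matrix \<^term>\<open>A\<close>.
\<close>

definition conj_transpose :: "complex^'n^'m \<Rightarrow> complex^'m^'n"
  where "conj_transpose A = (\<chi> i j. cnj (A $ j $ i))"

definition unitary_matrix :: "complex^'n^'n \<Rightarrow> bool"
  where "unitary_matrix U \<longleftrightarrow>
    conj_transpose U ** U = mat 1 \<and> U ** conj_transpose U = mat 1"

text \<open>
  Holomorphy in several variables: \<^const>\<open>has_derivative\<close> only provides a real-linear
  derivative, so its complex homogeneity is required separately.
\<close>

definition holomorphic_in :: "(complex^'n \<Rightarrow> complex) \<Rightarrow> (complex^'n) set \<Rightarrow> bool"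
  where "holomorphic_in f \<Omega> \<longleftrightarrow>
    (\<forall>z\<in>\<Omega>. \<exists>D. (f has_derivative D) (at z) \<and> (\<forall>c v. D (c *s v) = c * D v))"

text \<open>
  The algebra \<open>A(\<Omega>)\<close>. HOL functions are total; the values outside \<^term>\<open>closure \<Omega>\<close>
  are irrelevant.
\<close>

definition domain_algebra :: "(complex^'n) set \<Rightarrow> (complex^'n \<Rightarrow> complex) set"
  where "domain_algebra \<Omega> = {f. continuous_on (closure \<Omega>) f \<and> holomorphic_in f \<Omega>}"

definition boundary_for :: "(complex^'n) set \<Rightarrow> (complex^'n) set \<Rightarrow> bool"
  where "boundary_for \<Omega> C \<longleftrightarrow> C \<subseteq> closure \<Omega> \<and>
    (\<forall>f\<in>domain_algebra \<Omega>. \<exists>x\<in>C. \<forall>y\<in>closure \<Omega>. norm (f y) \<le> norm (f x))"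

text \<open>\<open>LEAST\<close> is taken with respect to inclusion of sets.\<close>

definition distinguished_boundary :: "(complex^'n) set \<Rightarrow> (complex^'n) set"
  where "distinguished_boundary \<Omega> = (LEAST C. closed C \<and> boundary_for \<Omega> C)"

definition pentablock :: "(complex^3) set"
  where "pentablock =
    {vector [A $ 2 $ 1, trace A, det A] | A :: complex^2^2. onorm ((*v) A) < 1}"

end

theory Submission
  imports Defs "HOL-Complex_Analysis.Conformal_Mappings"
begin

text \<open>
  The closure of the pentablock is the image of the contractions under
  \<open>\<pi>(A) = (a\<^sub>2\<^sub>1, tr A, det A)\<close>. A contraction that is not unitary is the centre of an affine disc of
  contractions, so by the maximum principle every \<open>f\<close> in the algebra attains its maximum modulus at some
  \<open>\<pi>(U) = (a, s, p)\<close> with \<open>U\<close> unitary. The disc \<open>{(z, s, p). |z|\<^sup>2 \<le> 1 - |s|\<^sup>2 / 4}\<close> also lies in the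
  closure, so the maximum moves to its rim, that is, to the set of \<open>(a, s, p)\<close> with \<open>|p| = 1\<close>,
  \<open>s = cnj s p\<close> and \<open>|a|\<^sup>2 + |s|\<^sup>2 / 4 = 1\<close>. All points of this set are peak points, so it is the
  distinguished boundary. A unitary \<open>U\<close> with determinant \<open>p\<close> satisfies
  \<open>u\<^sub>2\<^sub>2 = p cnj u\<^sub>1\<^sub>1\<close> and \<open>u\<^sub>1\<^sub>2 = - p cnj u\<^sub>2\<^sub>1\<close>; with \<open>u\<^sub>1\<^sub>1 = u\<^sub>2\<^sub>2\<close> it is therefore
  determined by \<open>(a, s, p)\<close>.
\<close>

section \<open>Contractions, adjoints and defect matrices\<close>

definition contractive :: "complex^'n^'m \<Rightarrow> bool"
  where "contractive A \<longleftrightarrow> (\<forall>x. norm (A *v x) \<le> norm x)"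

lemma contractive_iff_onorm: "contractive A \<longleftrightarrow> onorm ((*v) A) \<le> 1"
proof
  assume "contractive A"
  then show "onorm ((*v) A) \<le> 1"
    by (intro onorm_le) (simp add: contractive_def)
next
  assume *: "onorm ((*v) A) \<le> 1"
  show "contractive A"
    unfolding contractive_def
  proof
    fix x
    have "norm (A *v x) \<le> onorm ((*v) A) * norm x"
      by (rule onorm) simp
    also have "\<dots> \<le> 1 * norm x"
      using * by (intro mult_right_mono) auto
    finally show "norm (A *v x) \<le> norm x" by simp
  qed
qed

text \<open>The real inner product on complex vectors is the real part of the Hermitian one, so the
  conjugate transpose is its adjoint as well.\<close>

lemma inner_conj_transpose:
  "inner (conj_transpose A *v y) x = inner y (A *v x)"
proof -
  have inner_Re: "inner u v = Re (cnj u * v)" for u v :: complex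
    by (simp add: inner_complex_def)
  have "inner (conj_transpose A *v y) x = Re (\<Sum>i\<in>UNIV. \<Sum>j\<in>UNIV. A $ j $ i * cnj (y $ j) * x $ i)"
    by (simp add: inner_vec_def inner_Re matrix_vector_mult_def conj_transpose_def sum_distrib_right
)
  also have "\<dots> = Re (\<Sum>j\<in>UNIV. \<Sum>i\<in>UNIV. A $ j $ i * cnj (y $ j) * x $ i)"
    by (subst sum.swap) simp
  also have "\<dots> = inner y (A *v x)"
    by (simp add: inner_vec_def inner_Re matrix_vector_mult_def sum_distrib_left mult_ac)
  finally show ?thesis .
qed

lemma conj_transpose_conj_transpose [simp]: "conj_transpose (conj_transpose A) = A"
  by (simp add: conj_transpose_def vec_eq_iff)

lemma contractive_conj_transpose:
  assumes "contractive A"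
  shows "contractive (conj_transpose A)"
  unfolding contractive_def
proof
  fix y
  let ?z = "conj_transpose A *v y"
  have "(norm ?z)\<^sup>2 = inner y (A *v ?z)"
    by (simp add: power2_norm_eq_inner inner_conj_transpose)
  also have "\<dots> \<le> norm y * norm (A *v ?z)"
    by (rule norm_cauchy_schwarz)
  also have "\<dots> \<le> norm y * norm ?z"
    using assms by (intro mult_left_mono) (auto simp: contractive_def)
  finally show "norm ?z \<le> norm y"
    by (metis mult_right_le_imp_le norm_ge_zero order_le_less power2_eq_square)
qed

text \<open>Expanding the square gives \<open>|x|^2 - 2 |A x|^2 + |y|^2\<close> with
  \<open>y = conj_transpose A *v (A *v x)\<close>, and the adjoint is contractive, so
  \<open>|y| \<le> |A x|\<close>. Thus the defect of \<open>x\<close> is bounded by the room that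
  \<open>A\<close> leaves at \<open>x\<close>.\<close>

lemma norm_defect_le:
  assumes "contractive A"
  shows "(norm ((mat 1 - conj_transpose A ** A) *v x))\<^sup>2 \<le> (norm x)\<^sup>2 - (norm (A *v x))\<^sup>2"
proof -
  let ?y = "conj_transpose A *v (A *v x)"
  have "(mat 1 - conj_transpose A ** A) *v x = x - ?y"
    by (simp add: matrix_vector_mult_diff_rdistrib matrix_vector_mul_assoc)
  moreover have "(norm (x - ?y))\<^sup>2 = (norm x)\<^sup>2 - 2 * inner ?y x + (norm ?y)\<^sup>2"
    by (simp add: power2_norm_eq_inner inner_diff inner_commute)
  moreover have "inner ?y x = (norm (A *v x))\<^sup>2"
    by (simp add: inner_conj_transpose power2_norm_eq_inner)
  moreover have "(norm ?y)\<^sup>2 \<le> (norm (A *v x))\<^sup>2"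
    using contractive_conj_transpose[OF assms] by (simp add: contractive_def power_mono)
  ultimately show ?thesis by simp
qed

lemma mat_mult_vec: "mat c *v x = c *s (x :: 'a::comm_semiring_1^'n)"
  by (simp add: vec_eq_iff matrix_vector_mult_def mat_def if_distrib if_distribR cong: if_cong)

lemma norm_cmult_vec: "norm (c *s x) = norm c * norm (x :: complex^'n)"
  by (simp add: norm_vec_def norm_mult L2_set_def power_mult_distrib real_sqrt_mult flip: sum_distrib_left)

lemma norm_axis: "norm (axis i (x :: complex) :: complex^'n) = norm x"
proof -
  have "(norm (if P then x else 0))\<^sup>2 = (if P then (norm x)\<^sup>2 else 0)" for P
    by simp
  then show ?thesis
    by (simp add: norm_vec_def L2_set_def axis_def)
qed

lemma matrix_vector_mult_axis: "A *v axis j c = (\<chi> i. A $ i $ j * (c :: 'a::semiring_1))"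
  by (simp add: vec_eq_iff matrix_vector_mult_def axis_def if_distrib cong: if_cong)

text \<open>The direction is a multiple of \<open>(I - A A\<^sup>*) X (I - A\<^sup>* A)\<close> with a matrix unit \<open>X\<close>.\<close>

lemma non_unitary_contraction_disc:
  fixes A :: "complex^'n^'n"
  assumes A: "contractive A" and nu: "\<not> unitary_matrix A"
  obtains B where "B \<noteq> 0" "\<And>c. norm c \<le> 1 \<Longrightarrow> contractive (A + mat c ** B)"
proof -
  define E F where "E = mat 1 - conj_transpose A ** A" and "F = mat 1 - A ** conj_transpose A"
  \<comment> \<open>For square matrices a one-sided inverse is two-sided, so failure of one
    unitarity equation makes both defects nonzero.\<close>
  have "E \<noteq> 0" "F \<noteq> 0"
    using nu matrix_left_right_inverse[of "conj_transpose A" A]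
    by (auto simp: unitary_matrix_def E_def F_def)
  then obtain j l k i where nz: "E $ j $ l \<noteq> 0" "F $ k $ i \<noteq> 0"
    by (auto simp: vec_eq_iff)
  \<comment> \<open>The matrix unit is placed so that the entry \<open>(k, l)\<close> of
    \<open>B\<close> is \<open>F $ k $ i * E $ j $ l / 3\<close>. The factor 1/3 is small enough for
    the estimate below: \<open>2/3 + 1/9 \<le> 1\<close>.\<close>
  define X :: "complex^'n^'n" where "X = (\<chi> m n. if m = i \<and> n = j then 1/3 else 0)"
  define B where "B = F ** X ** E"
  have Xv: "X *v v = axis i (v $ j / 3)" for v
    by (simp add: X_def vec_eq_iff matrix_vector_mult_def axis_def if_distrib if_distribR cong: if_cong)
  have X: "norm (X *v v) \<le> norm v / 3" for v
    using Finite_Cartesian_Product.norm_nth_le[of v j] by (simp add: Xv norm_axis norm_divide)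
  have "B *v axis l 1 = F *v (X *v (E *v axis l 1))"
    by (simp only: B_def matrix_vector_mul_assoc matrix_mul_assoc)
  then have "B *v axis l 1 = (\<chi> m. F $ m $ i * (E $ j $ l / 3))"
    by (simp add: Xv matrix_vector_mult_axis)
  then have "(B *v axis l 1) $ k \<noteq> 0" using nz by simp
  then have "B \<noteq> 0" by auto
  moreover have "contractive (A + mat c ** B)" if c: "norm c \<le> 1" for c
    unfolding contractive_def
  proof
    fix x
    define e where "e = E *v x"
    define y where "y = c *s (X *v e)"
    have y: "norm y \<le> norm e / 3"
      using mult_mono[OF c X[of e]] by (simp add: y_def norm_cmult_vec)
    have "(A + mat c ** B) *v x = A *v x + F *v y"
      by (simp add: matrix_vector_mult_add_rdistrib B_def y_def e_def mat_mult_vec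
          flip: matrix_vector_mul_assoc) (simp add: matrix_vector_mult_def vec_eq_iff sum_distrib_left mult_ac)
    then have "(norm ((A + mat c ** B) *v x))\<^sup>2
        = (norm (A *v x))\<^sup>2 + 2 * inner (F *v y) (A *v x) + (norm (F *v y))\<^sup>2"
      by (simp add: power2_norm_eq_inner inner_add inner_commute)
    moreover have "inner (F *v y) (A *v x) \<le> (norm e)\<^sup>2 / 3"
    proof -
      have "F *v y = y - A *v (conj_transpose A *v y)"
        by (simp add: F_def matrix_vector_mult_diff_rdistrib matrix_vector_mul_assoc)
      \<comment> \<open>\<open>F\<close> is self-adjoint and \<open>F ** A = A ** E\<close>, so the
        defect passes from \<open>y\<close> to \<open>x\<close>.\<close>
      then have "inner (F *v y) (A *v x) = inner y (A *v e)"
        by (simp add: e_def E_def inner_diff matrix_vector_mult_diff_rdistrib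
            matrix_vector_mult_diff_distrib flip: matrix_vector_mul_assoc inner_conj_transpose)
      also have "\<dots> \<le> norm y * norm (A *v e)"
        by (rule norm_cauchy_schwarz)
      also have "\<dots> \<le> (norm e / 3) * norm e"
        using y A by (intro mult_mono) (auto simp: contractive_def)
      finally show ?thesis by (simp add: power2_eq_square)
    qed
    moreover have "(norm (F *v y))\<^sup>2 \<le> (norm e)\<^sup>2 / 9"
    proof -
      have "(norm (F *v y))\<^sup>2 \<le> (norm y)\<^sup>2 - (norm (conj_transpose A *v y))\<^sup>2"
        using norm_defect_le[OF contractive_conj_transpose[OF A], of y] by (simp add: F_def)
      also have "\<dots> \<le> (norm y)\<^sup>2" by simp
      also have "\<dots> \<le> (norm e / 3)\<^sup>2" using y by (intro power_mono) auto
      finally show ?thesis by (simp add: power_divide)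
    qed
    moreover have "(norm e)\<^sup>2 \<le> (norm x)\<^sup>2 - (norm (A *v x))\<^sup>2"
      using norm_defect_le[OF A, of x] by (simp add: e_def E_def)
    moreover have "0 \<le> (norm e)\<^sup>2" by simp
    ultimately have "(norm ((A + mat c ** B) *v x))\<^sup>2 \<le> (norm x)\<^sup>2"
      by linarith
    then show "norm ((A + mat c ** B) *v x) \<le> norm x"
      by (simp add: power2_le_iff_abs_le)
  qed
  ultimately show thesis using that by blast
qed

text \<open>A column is the image of a unit vector; a row is, up to conjugation, a column of the
  adjoint.\<close>

lemma contractive_row_col:
  assumes "contractive A"
  shows "norm ((A :: complex^'n^'m) $ i) \<le> 1" "norm (\<chi> i. A $ i $ j) \<le> 1"
proof -
  have col: "norm (\<chi> i. A $ i $ j) \<le> 1" if "contractive A" for A :: "complex^'c^'d" and j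
  proof -
    have "norm (A *v axis j 1) \<le> norm (axis j (1::complex))"
      using that by (metis contractive_def)
    then show ?thesis
      by (simp add: matrix_vector_mult_axis norm_axis)
  qed
  show "norm (\<chi> i. A $ i $ j) \<le> 1" by (rule col[OF assms])
  show "norm (A $ i) \<le> 1"
    using col[OF contractive_conj_transpose[OF assms], of i]
    by (simp add: conj_transpose_def norm_vec_def)
qed

lemma unitary_imp_contractive:
  assumes "unitary_matrix U"
  shows "contractive U"
  unfolding contractive_def
proof
  fix x
  have "inner (U *v x) (U *v x) = inner (conj_transpose U *v (U *v x)) x"
    by (simp add: inner_conj_transpose)
  also have "\<dots> = inner x x"
    using assms by (simp add: matrix_vector_mul_assoc unitary_matrix_def)
  finally show "norm (U *v x) \<le> norm x" by (simp add: norm_eq_sqrt_inner)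
qed

section \<open>The map onto the pentablock and the closure of its image\<close>

definition penta :: "complex^2^2 \<Rightarrow> complex^3"
  where "penta A = vector [A $ 2 $ 1, trace A, det A]"

text \<open>Scaling of matrices by \<open>r\<close>, transported by \<open>penta\<close>: the
  determinant is quadratic, whence the weight \<open>r^2\<close>.\<close>

definition pscale :: "real \<Rightarrow> complex^3 \<Rightarrow> complex^3"
  where "pscale r w = vector [r *\<^sub>R w $ 1, r *\<^sub>R w $ 2, r\<^sup>2 *\<^sub>R w $ 3]"

lemma pentablock_eq: "pentablock = penta ` {A. onorm ((*v) A) < 1}"
  by (auto simp: pentablock_def penta_def)

text \<open>Writes the vector as a sum of linear images of its entries, to which the rules for
  continuity and derivatives apply.\<close>

lemma vector_3_eq: "vector [a, b, c] = axis 1 a + axis 2 b + (axis 3 c :: complex^3)"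
  by (simp add: vec_eq_iff forall_3 axis_def)

lemma continuous_on_vector_3 [continuous_intros]:
  fixes f g h :: "'a::topological_space \<Rightarrow> complex"
  assumes "continuous_on S f" "continuous_on S g" "continuous_on S h"
  shows "continuous_on S (\<lambda>x. vector [f x, g x, h x] :: complex^3)"
proof -
  have "continuous_on S (\<lambda>x. if P then u x else 0)" if "continuous_on S u"
    for P and u :: "'a \<Rightarrow> complex"
    using that by (cases P) auto
  then show ?thesis
    unfolding vector_3_eq axis_def using assms by (intro continuous_intros)
qed

lemma continuous_on_penta: "continuous_on S penta"
  unfolding penta_def trace_def det_2 by (intro continuous_intros)

lemma penta_scaleR: "penta (r *\<^sub>R A) = pscale r (penta A)"
  by (simp add: penta_def pscale_def vec_eq_iff forall_3 trace_def sum_2 det_2 algebra_simps power2_eq_square)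

lemma onorm_matrix_scaleR: "onorm ((*v) (r *\<^sub>R (A :: complex^'n^'m))) = \<bar>r\<bar> * onorm ((*v) A)"
proof -
  have "(*v) (r *\<^sub>R A) = (\<lambda>x. r *\<^sub>R (A *v x))"
    by (simp add: fun_eq_iff vec_eq_iff matrix_vector_mult_def scaleR_sum_right)
  then show ?thesis
    using onorm_scaleR[of "(*v) A" r] by simp
qed

lemma compact_contractive: "compact {A :: complex^'n^'m. contractive A}"
proof (rule compact_eq_bounded_closed[THEN iffD2, OF conjI])
  have "norm A \<le> real CARD('m)" if "contractive A" for A :: "complex^'n^'m"
  proof -
    have "norm A \<le> (\<Sum>i\<in>UNIV. norm (A $ i))"
      by (simp add: norm_vec_def L2_set_le_sum)
    also have "\<dots> \<le> (\<Sum>i\<in>(UNIV::'m set). 1)"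
      by (intro sum_mono contractive_row_col that)
    finally show ?thesis by simp
  qed
  then show "bounded {A :: complex^'n^'m. contractive A}"
    by (auto simp: bounded_iff)
  have "closed {A :: complex^'n^'m. norm (A *v x) \<le> norm x}" for x
    unfolding matrix_vector_mult_def by (intro closed_Collect_le continuous_intros)
  then show "closed {A :: complex^'n^'m. contractive A}"
    unfolding contractive_def by (rule closed_Collect_all)
qed

lemma contractive_scale_in_pentablock:
  assumes "contractive A" "0 \<le> r" "r < 1"
  shows "penta (r *\<^sub>R A) \<in> pentablock"
proof -
  have "r * onorm ((*v) A) \<le> r * 1"
    using assms by (intro mult_left_mono) (auto simp: contractive_iff_onorm)
  then show ?thesis
    using assms by (auto simp: pentablock_eq onorm_matrix_scaleR)
qed

text \<open>The image of the compact set of contractions is closed, and each contraction is the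
  limit of the strict contractions \<open>r *\<^sub>R A\<close> as \<open>r\<close> tends to
  1.\<close>

lemma closure_pentablock: "closure pentablock = penta ` {A. contractive A}"
proof
  have "compact (penta ` {A. contractive A})"
    by (intro compact_continuous_image continuous_on_penta compact_contractive)
  moreover have "pentablock \<subseteq> penta ` {A. contractive A}"
    by (auto simp: pentablock_eq contractive_iff_onorm)
  ultimately show "closure pentablock \<subseteq> penta ` {A. contractive A}"
    by (intro closure_minimal compact_imp_closed)
  show "penta ` {A. contractive A} \<subseteq> closure pentablock"
  proof clarify
    fix A :: "complex^2^2" assume "contractive A"
    then have "(\<lambda>r. penta (r *\<^sub>R A)) ` {0..<1} \<subseteq> closure pentablock"
      using contractive_scale_in_pentablock closure_subset by fastforce
    moreover have "continuous_on (closure {0..<1}) (\<lambda>r. penta (r *\<^sub>R A))"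
      by (intro continuous_on_compose2[OF continuous_on_penta[of UNIV]] continuous_intros) auto
    ultimately have "(\<lambda>r. penta (r *\<^sub>R A)) ` closure {0..<1} \<subseteq> closure pentablock"
      by (intro image_closure_subset) auto
    moreover have "1 \<in> closure {0..<1 :: real}" by simp
    ultimately have "penta (1 *\<^sub>R A) \<in> closure pentablock" by blast
    then show "penta A \<in> closure pentablock" by simp
  qed
qed

lemma compact_closure_pentablock: "compact (closure pentablock)"
  unfolding closure_pentablock
  by (intro compact_continuous_image continuous_on_penta compact_contractive)

lemma pscale_in_pentablock:
  assumes "w \<in> closure pentablock" "0 \<le> r" "r < 1"
  shows "pscale r w \<in> pentablock"
  using assms contractive_scale_in_pentablock by (auto simp: closure_pentablock simp flip: penta_scaleR)

lemma pscale_1 [simp]: "pscale 1 w = w"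
  by (simp add: pscale_def vec_eq_iff forall_3)

lemma pscale_in_closure:
  assumes "w \<in> closure pentablock" "0 \<le> r" "r \<le> 1"
  shows "pscale r w \<in> closure pentablock"
  using assms pscale_in_pentablock closure_subset by (cases "r = 1") fastforce+

section \<open>Holomorphic discs in the pentablock and in its closure\<close>

text \<open>Chain rule: the disc has derivative \<open>h *s v\<close>, and complex homogeneity turns
  \<open>D (h *s v)\<close> into \<open>h * D v\<close>, a complex derivative.\<close>

lemma holomorphic_compose_inside:
  fixes f :: "complex^3 \<Rightarrow> complex"
  assumes f: "holomorphic_in f \<Omega>" and S: "open S"
    and \<phi>: "\<phi>1 holomorphic_on S" "\<phi>2 holomorphic_on S" "\<phi>3 holomorphic_on S"
    and in_\<Omega>: "\<And>z. z \<in> S \<Longrightarrow> vector [\<phi>1 z, \<phi>2 z, \<phi>3 z] \<in> \<Omega>"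
  shows "(\<lambda>z. f (vector [\<phi>1 z, \<phi>2 z, \<phi>3 z])) holomorphic_on S"
proof (rule holomorphic_onI)
  fix z assume z: "z \<in> S"
  let ?w = "\<lambda>z. vector [\<phi>1 z, \<phi>2 z, \<phi>3 z] :: complex^3"
  obtain D where D: "(f has_derivative D) (at (?w z))" and lin: "\<And>c v. D (c *s v) = c * D v"
    using f in_\<Omega>[OF z] unfolding holomorphic_in_def by blast
  obtain d1 d2 d3 where d: "(\<phi>1 has_field_derivative d1) (at z)"
      "(\<phi>2 has_field_derivative d2) (at z)" "(\<phi>3 has_field_derivative d3) (at z)"
    using \<phi> z S by (meson holomorphic_derivI)
  have ax: "bounded_linear (axis i :: complex \<Rightarrow> complex^3)" for i
    by (intro linear_conv_bounded_linear[THEN iffD1] linearI)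
      (auto simp: vec_eq_iff axis_def)
  have "(?w has_derivative (\<lambda>h. axis 1 (d1 * h) + axis 2 (d2 * h) + axis 3 (d3 * h))) (at z)"
    unfolding vector_3_eq
    by (intro has_derivative_add bounded_linear.has_derivative[OF ax])
      (use d in \<open>simp_all add: has_field_derivative_def\<close>)
  then have "(?w has_derivative (\<lambda>h. h *s vector [d1, d2, d3])) (at z)"
    by (rule has_derivative_eq_rhs) (simp add: fun_eq_iff vec_eq_iff forall_3 axis_def mult_ac)
  from has_derivative_compose[OF this D]
  have "((\<lambda>z. f (?w z)) has_field_derivative D (vector [d1, d2, d3])) (at z)"
    by (simp add: lin has_field_derivative_def mult_commute_abs)
  then show "(\<lambda>z. f (?w z)) field_differentiable (at z within S)"
    using field_differentiable_at_within field_differentiable_def by blast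
qed

text \<open>The disc may touch the boundary of the pentablock, so the composition is obtained as a
  uniform limit of compositions with the maps \<open>pscale r\<close>, \<open>r \<rightarrow> 1\<close>.\<close>

lemma holomorphic_compose_closure:
  assumes f: "f \<in> domain_algebra pentablock" and S: "open S"
    and \<phi>: "\<phi>1 holomorphic_on S" "\<phi>2 holomorphic_on S" "\<phi>3 holomorphic_on S"
    and in_cl: "\<And>z. z \<in> S \<Longrightarrow> vector [\<phi>1 z, \<phi>2 z, \<phi>3 z] \<in> closure pentablock"
  shows "(\<lambda>z. f (vector [\<phi>1 z, \<phi>2 z, \<phi>3 z])) holomorphic_on S"
proof -
  let ?w = "\<lambda>z. vector [\<phi>1 z, \<phi>2 z, \<phi>3 z] :: complex^3"
  define r where "r = (\<lambda>n. 1 - inverse (real (Suc n)))"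
  have r: "0 \<le> r n" "r n < 1" for n
    by (auto simp: r_def field_simps)
  have r_lim: "r \<longlonglongrightarrow> 1"
    using tendsto_diff[OF tendsto_const LIMSEQ_inverse_real_of_nat, of 1] by (simp add: r_def)
  have hol: "(\<lambda>z. f (pscale (r n) (?w z))) holomorphic_on S" for n
  proof -
    have "(\<lambda>z. f (vector [r n *\<^sub>R \<phi>1 z, r n *\<^sub>R \<phi>2 z, (r n)\<^sup>2 *\<^sub>R \<phi>3 z])) holomorphic_on S"
    proof (rule holomorphic_compose_inside[OF _ S])
      show "holomorphic_in f pentablock" using f by (simp add: domain_algebra_def)
      show "vector [r n *\<^sub>R \<phi>1 z, r n *\<^sub>R \<phi>2 z, (r n)\<^sup>2 *\<^sub>R \<phi>3 z] \<in> pentablock" if "z \<in> S" for z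
        using pscale_in_pentablock[OF in_cl[OF that] r] by (simp add: pscale_def)
    qed (use \<phi> in \<open>auto simp: scaleR_conv_of_real intro!: holomorphic_intros\<close>)
    then show ?thesis by (simp add: pscale_def)
  qed
  let ?K = "{0..1} \<times> closure pentablock"
  let ?g = "\<lambda>(t, w). f (pscale t w)"
  have "continuous_on (closure pentablock) f"
    using f by (simp add: domain_algebra_def)
  then have "continuous_on ?K (\<lambda>x. f (pscale (fst x) (snd x)))"
    by (rule continuous_on_compose2)
      (auto simp: pscale_def[abs_def] pscale_in_closure[unfolded pscale_def] intro!: continuous_intros)
  \<comment> \<open>Comparing \<open>(t, w)\<close> with \<open>(1, w)\<close> on this compact set
    gives a \<open>\<delta>\<close> independent of \<open>w\<close>, hence uniform convergence along
    the whole disc.\<close>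
  then have "uniformly_continuous_on ?K ?g"
    by (intro compact_uniformly_continuous compact_Times compact_closure_pentablock)
      (auto simp: case_prod_unfold)
  then have unif: "\<exists>\<delta>>0. \<forall>t\<in>{0..1}. \<forall>w\<in>closure pentablock. dist t 1 < \<delta> \<longrightarrow> dist (f (pscale t w)) (f w) < e"
    if "e > 0" for e
    unfolding uniformly_continuous_on_def using that by (fastforce simp: dist_Pair_Pair dest!: spec)
  have "uniform_limit S (\<lambda>n z. f (pscale (r n) (?w z))) (\<lambda>z. f (?w z)) sequentially"
  proof (rule uniform_limitI)
    fix e :: real assume "e > 0"
    with unif obtain \<delta> where \<delta>: "\<delta> > 0"
      "\<And>t w. t \<in> {0..1} \<Longrightarrow> w \<in> closure pentablock \<Longrightarrow> dist t 1 < \<delta> \<Longrightarrow> dist (f (pscale t w)) (f w) < e"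
      by meson
    have "\<forall>\<^sub>F n in sequentially. dist (r n) 1 < \<delta>"
      using r_lim \<delta>(1) by (rule tendstoD)
    then show "\<forall>\<^sub>F n in sequentially. \<forall>z\<in>S. dist (f (pscale (r n) (?w z))) (f (?w z)) < e"
      by eventually_elim (use r in_cl in \<open>auto intro!: \<delta>(2) less_imp_le\<close>)
  qed
  then have "\<exists>d>0. cball z d \<subseteq> S \<and>
      uniform_limit (cball z d) (\<lambda>n z. f (pscale (r n) (?w z))) (\<lambda>z. f (?w z)) sequentially"
    if "z \<in> S" for z
    using S that by (meson open_contains_cball uniform_limit_on_subset)
  with S hol show ?thesis
    by (rule holomorphic_uniform_sequence)
qed

section \<open>Unitary 2 by 2 matrices and the torus\<close>

text \<open>The second column is \<open>p\<close> times the unit vector that is orthogonal to the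
  first and completes it to determinant 1.\<close>

lemma unitary_matrix_2I:
  fixes U :: "complex^2^2"
  assumes "norm p = 1" "(norm (U $ 1 $ 1))\<^sup>2 + (norm (U $ 2 $ 1))\<^sup>2 = 1"
    and "U $ 2 $ 2 = p * cnj (U $ 1 $ 1)" "U $ 1 $ 2 = - p * cnj (U $ 2 $ 1)"
  shows "unitary_matrix U" "det U = p"
proof -
  have p: "p * cnj p = 1"
    using assms(1) by (simp flip: complex_norm_square)
  have "complex_of_real ((norm (U $ 1 $ 1))\<^sup>2 + (norm (U $ 2 $ 1))\<^sup>2) = 1"
    using assms(2) by simp
  then have n: "U $ 1 $ 1 * cnj (U $ 1 $ 1) + U $ 2 $ 1 * cnj (U $ 2 $ 1) = 1"
    unfolding of_real_add complex_norm_square .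
  show "unitary_matrix U"
    unfolding unitary_matrix_def
    by (simp add: vec_eq_iff forall_2 matrix_matrix_mult_def conj_transpose_def sum_2 mat_def assms(3,4))
      (use p n in algebra)
  show "det U = p"
    unfolding det_2 assms(3,4) using n by algebra
qed

text \<open>The inverse of \<open>U\<close> is both its conjugate transpose and its adjugate divided
  by \<open>det U\<close>; the entries are compared.\<close>

lemma unitary_matrix_2D:
  fixes U :: "complex^2^2"
  assumes "unitary_matrix U"
  shows "norm (det U) = 1" "(norm (U $ 1 $ 1))\<^sup>2 + (norm (U $ 2 $ 1))\<^sup>2 = 1"
    and "U $ 2 $ 2 = det U * cnj (U $ 1 $ 1)" "U $ 1 $ 2 = - det U * cnj (U $ 2 $ 1)"
proof -
  have c: "U $ 1 $ 1 * cnj (U $ 1 $ 1) + U $ 2 $ 1 * cnj (U $ 2 $ 1) = 1"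
    "U $ 1 $ 2 * cnj (U $ 1 $ 2) + U $ 2 $ 2 * cnj (U $ 2 $ 2) = 1"
    "cnj (U $ 1 $ 1) * U $ 1 $ 2 + cnj (U $ 2 $ 1) * U $ 2 $ 2 = 0"
    "U $ 1 $ 1 * cnj (U $ 1 $ 1) + U $ 1 $ 2 * cnj (U $ 1 $ 2) = 1"
    "U $ 2 $ 1 * cnj (U $ 1 $ 1) + U $ 2 $ 2 * cnj (U $ 1 $ 2) = 0"
    using assms unfolding unitary_matrix_def
    by (simp_all add: vec_eq_iff forall_2 matrix_matrix_mult_def conj_transpose_def sum_2 mat_def mult_ac)
  show w: "U $ 2 $ 2 = det U * cnj (U $ 1 $ 1)" and y: "U $ 1 $ 2 = - det U * cnj (U $ 2 $ 1)"
    unfolding det_2 using c by algebra+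
  have of_r: "complex_of_real ((norm u)\<^sup>2 + (norm v)\<^sup>2) = u * cnj u + v * cnj v" for u v
    unfolding of_real_add complex_norm_square ..
  show n: "(norm (U $ 1 $ 1))\<^sup>2 + (norm (U $ 2 $ 1))\<^sup>2 = 1"
    using c(1) of_r of_real_eq_1_iff by metis
  have "(norm (U $ 1 $ 2))\<^sup>2 + (norm (U $ 2 $ 2))\<^sup>2 = 1"
    using c(2) of_r of_real_eq_1_iff by metis
  \<comment> \<open>By \<open>w\<close> and \<open>y\<close> the second column is
    \<open>norm (det U)\<close> times as long as the first, and both are unit vectors.\<close>
  then have "(norm (det U))\<^sup>2 * ((norm (U $ 1 $ 1))\<^sup>2 + (norm (U $ 2 $ 1))\<^sup>2) = 1"
    using arg_cong[OF w, of norm] arg_cong[OF y, of norm]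
    by (simp add: norm_mult power_mult_distrib algebra_simps)
  then show "norm (det U) = 1"
    by (simp add: n power2_eq_1_iff) (use norm_ge_zero[of "det U"] in linarith)
qed

text \<open>The known formula for the distinguished boundary; the squared equation contains both
  \<open>|s| \<le> 2\<close> and \<open>|a| = sqrt (1 - |s|^2 / 4)\<close>.\<close>

definition penta_torus :: "(complex^3) set"
  where "penta_torus = {w. norm (w $ 3) = 1 \<and> (norm (w $ 1))\<^sup>2 + (norm (w $ 2 / 2))\<^sup>2 = 1 \<and>
    w $ 2 = cnj (w $ 2) * w $ 3}"

text \<open>Equal diagonal entries must be \<open>s / 2\<close>, so the relation between the
  diagonal entries of a unitary matrix becomes \<open>s = cnj s * p\<close>.\<close>

lemma penta_torus_iff_unique_unitary:
  "vector [a, s, p] \<in> penta_torus \<longleftrightarrow>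
    (\<exists>!U :: complex^2^2. unitary_matrix U \<and> U $ 1 $ 1 = U $ 2 $ 2 \<and>
       (a, s, p) = (U $ 2 $ 1, trace U, det U))"
proof
  assume K: "vector [a, s, p] \<in> penta_torus"
  let ?V = "\<chi> i j. if i = j then s / 2 else if i = 2 then a else - p * cnj a :: complex^2^2"
  have V: "unitary_matrix ?V" "det ?V = p"
    by (rule unitary_matrix_2I[of p]; use K in \<open>simp add: penta_torus_def add.commute mult.commute\<close>)+
  show "\<exists>!U :: complex^2^2. unitary_matrix U \<and> U $ 1 $ 1 = U $ 2 $ 2 \<and>
       (a, s, p) = (U $ 2 $ 1, trace U, det U)"
  proof (rule ex1I[of _ ?V], goal_cases)
    case 1
    then show ?case using V by (simp add: trace_def sum_2)
  next
    case (2 U)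
    then have "U $ 1 $ 2 = - p * cnj a"
      using unitary_matrix_2D(4)[of U] by simp
    with 2 show ?case
      by (simp add: vec_eq_iff forall_2 trace_def sum_2)
  qed
next
  assume "\<exists>!U :: complex^2^2. unitary_matrix U \<and> U $ 1 $ 1 = U $ 2 $ 2 \<and>
       (a, s, p) = (U $ 2 $ 1, trace U, det U)"
  then obtain U :: "complex^2^2" where U: "unitary_matrix U" "U $ 1 $ 1 = U $ 2 $ 2"
    "a = U $ 2 $ 1" "s = trace U" "p = det U" by auto
  have s: "s = 2 * U $ 1 $ 1"
    using U by (simp add: trace_def sum_2)
  have "(norm a)\<^sup>2 + (norm (s / 2))\<^sup>2 = 1" "norm p = 1"
    using unitary_matrix_2D(1,2)[OF U(1)] by (simp_all add: U(3,5) s)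
  moreover have "s = cnj s * p"
    unfolding s U(5) complex_cnj_mult complex_cnj_numeral
    using unitary_matrix_2D(3)[OF U(1)] U(2) by algebra
  ultimately show "vector [a, s, p] \<in> penta_torus"
    by (simp add: penta_torus_def)
qed

text \<open>For \<open>x = s / 2\<close> and \<open>t\<^sup>2 = - p (1 - |x|\<^sup>2 - |z|\<^sup>2)\<close> the matrix with diagonal \<open>x + t, x - t\<close>,
  lower left entry \<open>z\<close> and determinant \<open>p\<close> is unitary.\<close>

lemma fibre_disc_in_closure:
  assumes p: "norm p = 1" and s: "s = cnj s * p" and z: "(norm z)\<^sup>2 + (norm (s / 2))\<^sup>2 \<le> 1"
  shows "vector [z, s, p] \<in> closure pentablock"
proof -
  define x \<beta> w where "x = s / 2" and "\<beta> = sqrt (1 - (norm x)\<^sup>2 - (norm z)\<^sup>2)" and "w = csqrt (- p)"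
  define t where "t = \<beta> * w"
  let ?U = "\<chi> i j. if i = 1 then if j = 1 then x + t else - p * cnj z
    else if j = 1 then z else x - t :: complex^2^2"
  have x: "p * cnj x = x"
    using s by (simp add: x_def mult.commute)
  have \<beta>: "\<beta>\<^sup>2 = 1 - (norm x)\<^sup>2 - (norm z)\<^sup>2"
    using z by (simp add: \<beta>_def x_def)
  have w2: "w\<^sup>2 = - p"
    by (simp add: w_def)
  have "(norm w)\<^sup>2 = 1"
    using p w2 by (metis norm_minus_cancel norm_power)
  then have "w * cnj w = 1"
    by (metis complex_norm_square of_real_1)
  then have t: "p * cnj t = - t"
    using w2 by (simp add: t_def) algebra
  \<comment> \<open>Since \<open>p * cnj x = x\<close> and \<open>p * cnj t = - t\<close>, the
    numbers \<open>x\<close> and \<open>t\<close> are orthogonal in the real plane. This is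
    Pythagoras multiplied by \<open>p\<close>, which removes the conjugates.\<close>
  have \<section>: "p * complex_of_real ((norm (x + t))\<^sup>2) = p * complex_of_real ((norm x)\<^sup>2 + \<beta>\<^sup>2)"
  proof -
    have "p * complex_of_real ((norm (x + t))\<^sup>2) = (x + t) * (p * cnj x + p * cnj t)"
      unfolding complex_norm_square by (simp add: algebra_simps)
    also have "\<dots> = x * (p * cnj x) - \<beta>\<^sup>2 * w\<^sup>2"
      unfolding x t by (simp add: t_def algebra_simps power2_eq_square)
    also have "\<dots> = p * (complex_of_real ((norm x)\<^sup>2) + \<beta>\<^sup>2)"
      unfolding complex_norm_square w2 by (simp add: algebra_simps)
    finally show ?thesis by simp
  qed
  have "p \<noteq> 0" using p by auto
  with \<section> have n: "(norm (x + t))\<^sup>2 = (norm x)\<^sup>2 + \<beta>\<^sup>2"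
    unfolding mult_cancel_left of_real_eq_iff by blast
  have U: "unitary_matrix ?U" "det ?U = p"
    by (rule unitary_matrix_2I[of p]; use p n \<beta> x t in \<open>simp add: distrib_left\<close>)+
  have "penta ?U \<in> closure pentablock"
    unfolding closure_pentablock using unitary_imp_contractive[OF U(1)] by blast
  moreover have "penta ?U = vector [z, s, p]"
    unfolding penta_def U(2) by (simp add: trace_def sum_2 x_def)
  ultimately show ?thesis by simp
qed

lemma penta_torus_subset_closure: "penta_torus \<subseteq> closure pentablock"
proof
  fix w :: "complex^3" assume "w \<in> penta_torus"
  then have "vector [w $ 1, w $ 2, w $ 3] \<in> closure pentablock"
    by (intro fibre_disc_in_closure) (auto simp: penta_torus_def)
  moreover have "vector [w $ 1, w $ 2, w $ 3] = w"
    by (simp add: vec_eq_iff forall_3)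
  ultimately show "w \<in> closure pentablock" by simp
qed

lemma closed_penta_torus: "closed penta_torus"
  unfolding penta_torus_def
  by (intro closed_Collect_conj closed_Collect_eq continuous_intros) simp_all

section \<open>Bounds on the closure and peak points\<close>

lemma norm_vec_2: "(norm (v :: complex^2))\<^sup>2 = (norm (v $ 1))\<^sup>2 + (norm (v $ 2))\<^sup>2"
  by (simp add: norm_vec_def L2_set_def sum_2)

text \<open>The first bound averages those for the second row and the first column, after convexity
  of the square is applied to half the trace. For the second, \<open>2 x y \<le> x^2 + y^2\<close>
  bounds the determinant by the mean of the squared column norms.\<close>

lemma closure_pentablock_bounds:
  assumes "w \<in> closure pentablock"
  shows "(norm (w $ 1))\<^sup>2 + (norm (w $ 2 / 2))\<^sup>2 \<le> 1" "norm (w $ 3) \<le> 1"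
proof -
  obtain A :: "complex^2^2" where A: "contractive A" and w: "w = penta A"
    using assms by (auto simp: closure_pentablock)
  have row: "(norm (A $ 2 $ 1))\<^sup>2 + (norm (A $ 2 $ 2))\<^sup>2 \<le> 1"
    using power_mono[OF contractive_row_col(1)[OF A, of 2], of 2] by (simp add: norm_vec_2)
  have col: "(norm (A $ 1 $ j))\<^sup>2 + (norm (A $ 2 $ j))\<^sup>2 \<le> 1" for j
    using power_mono[OF contractive_row_col(2)[OF A, of j], of 2] by (simp add: norm_vec_2)
  have "(norm ((A $ 1 $ 1 + A $ 2 $ 2) / 2))\<^sup>2 \<le> ((norm (A $ 1 $ 1) + norm (A $ 2 $ 2)) / 2)\<^sup>2"
    using norm_triangle_ineq by (intro power_mono) (auto simp: norm_divide)
  also have "\<dots> \<le> ((norm (A $ 1 $ 1))\<^sup>2 + (norm (A $ 2 $ 2))\<^sup>2) / 2"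
    using sum_squares_bound[of "norm (A $ 1 $ 1)" "norm (A $ 2 $ 2)"] by (simp add: power2_sum power_divide)
  finally show "(norm (w $ 1))\<^sup>2 + (norm (w $ 2 / 2))\<^sup>2 \<le> 1"
    using row col[of 1] by (simp add: w penta_def trace_def sum_2)
  have "norm (det A) \<le> norm (A $ 1 $ 1) * norm (A $ 2 $ 2) + norm (A $ 1 $ 2) * norm (A $ 2 $ 1)"
    using norm_triangle_ineq4[of "A $ 1 $ 1 * A $ 2 $ 2" "A $ 1 $ 2 * A $ 2 $ 1"]
    by (simp add: det_2 norm_mult)
  then show "norm (w $ 3) \<le> 1"
    using sum_squares_bound[of "norm (A $ 1 $ 1)" "norm (A $ 2 $ 2)"]
      sum_squares_bound[of "norm (A $ 1 $ 2)" "norm (A $ 2 $ 1)"] col[of 1] col[of 2]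
    by (simp add: w penta_def)
qed

text \<open>Equality in the triangle inequality: removing \<open>v\<close> leaves
  \<open>|1 + u| \<ge> 2\<close>, and the parallelogram law
  \<open>|1 + u|^2 + |u - 1|^2 = 2 + 2 |u|^2\<close> then forces \<open>u = 1\<close>.\<close>

lemma three_unit_sum_eq:
  fixes u v :: complex
  assumes "norm u \<le> 1" "norm v \<le> 1" "norm (1 + u + v) \<ge> 3"
  shows "u = 1" "v = 1"
proof -
  have *: "u = 1" if "norm u \<le> 1" "norm v \<le> 1" "norm (1 + u + v) \<ge> 3" for u v :: complex
  proof -
    have "2 \<le> norm (1 + u)"
      using norm_triangle_ineq[of "1 + u" v] that by linarith
    then have "2\<^sup>2 \<le> (norm (1 + u))\<^sup>2"
      by (intro power_mono) auto
    moreover have "(norm u)\<^sup>2 \<le> 1"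
      using that by (simp add: power_le_one)
    ultimately have "(norm (u - 1))\<^sup>2 \<le> 0"
      unfolding cmod_power2 by (simp add: power2_eq_square algebra_simps)
    then show ?thesis by simp
  qed
  show "u = 1" using *[of u v] assms by simp
  show "v = 1" using *[of v u] assms by (simp add: add_ac)
qed

text \<open>Every point \<open>k\<close> of the torus is a peak point: by the Cauchy--Schwarz inequality,
  \<open>1 + cnj k\<^sub>1 y\<^sub>1 + cnj k\<^sub>2 y\<^sub>2 / 4 + cnj k\<^sub>3 y\<^sub>3\<close> has modulus at most 3 on the closure,
  with equality only at \<open>y = k\<close>.\<close>

lemma penta_torus_subset_boundary:
  assumes C: "boundary_for pentablock C"
  shows "penta_torus \<subseteq> C"
proof
  fix k :: "complex^3" assume k: "k \<in> penta_torus"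
  have k12: "(norm (k $ 1))\<^sup>2 + (norm (k $ 2 / 2))\<^sup>2 = 1" and k3: "norm (k $ 3) = 1"
    using k by (auto simp: penta_torus_def)
  \<comment> \<open>The Hermitian product with \<open>(k $ 1, k $ 2 / 2)\<close>, which is a unit
    vector because \<open>k\<close> lies on the torus.\<close>
  define L where "L = (\<lambda>y :: complex^3. cnj (k $ 1) * y $ 1 + cnj (k $ 2 / 2) * (y $ 2 / 2))"
  define f where "f = (\<lambda>y :: complex^3. 1 + L y + cnj (k $ 3) * y $ 3)"
  have "holomorphic_in f pentablock"
    unfolding holomorphic_in_def
  proof (intro ballI exI conjI allI)
    fix z
    show "(f has_derivative (\<lambda>h. L h + cnj (k $ 3) * h $ 3)) (at z)"
      unfolding f_def L_def
      by (auto intro!: derivative_eq_intros bounded_linear.has_derivative[OF bounded_linear_vec_nth])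
    show "L (c *s v) + cnj (k $ 3) * (c *s v) $ 3 = c * (L v + cnj (k $ 3) * v $ 3)" for c v
      by (simp add: L_def algebra_simps)
  qed
  then have "f \<in> domain_algebra pentablock"
    by (auto simp: domain_algebra_def f_def L_def intro!: continuous_intros)
  then obtain x where x: "x \<in> C" and max: "\<And>y. y \<in> closure pentablock \<Longrightarrow> norm (f y) \<le> norm (f x)"
    using C by (meson boundary_for_def)
  have xb: "(norm (x $ 1))\<^sup>2 + (norm (x $ 2 / 2))\<^sup>2 \<le> 1" "norm (x $ 3) \<le> 1"
    using x C closure_pentablock_bounds[of x] by (auto simp: boundary_for_def)
  have "L k = complex_of_real ((norm (k $ 1))\<^sup>2 + (norm (k $ 2 / 2))\<^sup>2)"
    unfolding L_def of_real_add complex_norm_square by (simp add: mult_ac)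
  moreover have "cnj (k $ 3) * k $ 3 = 1"
    using k3 by (metis complex_norm_square mult.commute of_real_1 one_power2)
  ultimately have "norm (f k) = 3"
    unfolding f_def k12 by simp
  then have ge: "norm (1 + L x + cnj (k $ 3) * x $ 3) \<ge> 3"
    using max[of k] k penta_torus_subset_closure unfolding f_def by auto
  have "norm (L x) \<le> norm (k $ 1) * norm (x $ 1) + norm (k $ 2 / 2) * norm (x $ 2 / 2)"
    unfolding L_def by (metis complex_mod_cnj norm_mult norm_triangle_ineq)
  then have "norm (L x) \<le> 1"
    using sum_squares_bound[of "norm (k $ 1)" "norm (x $ 1)"]
      sum_squares_bound[of "norm (k $ 2 / 2)" "norm (x $ 2 / 2)"] k12 xb(1) by linarith
  then have eq: "L x = 1" "cnj (k $ 3) * x $ 3 = 1"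
    using three_unit_sum_eq[OF _ _ ge] k3 xb(2) by (auto simp: norm_mult)
  have "x $ 3 = k $ 3"
    using eq(2) \<open>cnj (k $ 3) * k $ 3 = 1\<close> by algebra
  \<comment> \<open>Equality in Cauchy-Schwarz: with \<open>L x = 1\<close> this squared distance is
    at most 1 + 1 - 2 = 0.\<close>
  moreover have "(norm (x $ 1 - k $ 1))\<^sup>2 + (norm (x $ 2 / 2 - k $ 2 / 2))\<^sup>2
      = ((norm (x $ 1))\<^sup>2 + (norm (x $ 2 / 2))\<^sup>2)
        + ((norm (k $ 1))\<^sup>2 + (norm (k $ 2 / 2))\<^sup>2) - 2 * Re (L x)"
    unfolding cmod_power2 L_def by (simp add: power2_eq_square algebra_simps)
  then have "(norm (x $ 1 - k $ 1))\<^sup>2 + (norm (x $ 2 / 2 - k $ 2 / 2))\<^sup>2 \<le> 0"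
    using xb(1) k12 eq(1) by simp
  then have "x $ 1 = k $ 1" "x $ 2 = k $ 2"
    by (simp_all add: sum_power2_le_zero_iff)
  ultimately have "x = k"
    by (simp add: vec_eq_iff forall_3)
  with x show "k \<in> C" by simp
qed

section \<open>Maximum modulus: from contractions to unitaries to the torus\<close>

text \<open>A maximizer of largest Hilbert--Schmidt norm cannot be the centre of a disc of contractions,
  since the modulus is constant along such a disc.\<close>

lemma domain_algebra_max_at_unitary:
  assumes f: "f \<in> domain_algebra pentablock"
  obtains U where "unitary_matrix U" "\<And>y. y \<in> closure pentablock \<Longrightarrow> norm (f y) \<le> norm (f (penta U))"
proof -
  let ?C = "{A :: complex^2^2. contractive A}"
  let ?g = "\<lambda>A. norm (f (penta A))"
  have cf: "continuous_on (closure pentablock) f"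
    using f by (simp add: domain_algebra_def)
  have cg: "continuous_on ?C ?g"
    by (intro continuous_on_norm continuous_on_compose2[OF cf continuous_on_penta])
      (simp add: closure_pentablock)
  have "(0 :: complex^2^2) \<in> ?C"
    by (simp add: contractive_def)
  then obtain A0 where A0: "A0 \<in> ?C" "\<And>A. A \<in> ?C \<Longrightarrow> ?g A \<le> ?g A0"
    using continuous_attains_sup[OF compact_contractive _ cg] by blast
  define T where "T = {A \<in> ?C. ?g A = ?g A0}"
  have "closed T"
    using continuous_closed_preimage_constant[OF cg, of "?g A0"] compact_contractive
    unfolding T_def by (metis compact_imp_closed)
  then have "compact T"
    using compact_contractive compact_Int_closed[of ?C T] by (simp add: T_def Int_def conj_commute conj_left_commute)
  moreover have "A0 \<in> T" using A0 by (simp add: T_def)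
  ultimately obtain A where A: "A \<in> T" "\<And>B. B \<in> T \<Longrightarrow> norm B \<le> norm A"
    using continuous_attains_sup[of T norm] continuous_on_norm_id by blast
  have max: "?g B \<le> ?g A" if "contractive B" for B
    using A A0(2)[of B] that by (simp add: T_def)
  have "unitary_matrix A"
  proof (rule ccontr)
    assume "\<not> unitary_matrix A"
    then obtain B where B: "B \<noteq> 0" "\<And>c. norm c \<le> 1 \<Longrightarrow> contractive (A + mat c ** B)"
      using A by (metis (mono_tags, lifting) T_def mem_Collect_eq non_unitary_contraction_disc)
    let ?M = "\<lambda>c. A + mat c ** B"
    have nth: "(mat c ** B) $ i $ j = c * B $ i $ j" for c i j
      by (simp add: matrix_matrix_mult_def mat_def if_distrib if_distribR cong: if_cong)
    let ?h = "\<lambda>c. f (penta (?M c))"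
    have "?h holomorphic_on ball 0 1"
      unfolding penta_def
    proof (rule holomorphic_compose_closure[OF f open_ball])
      show "vector [?M z $ 2 $ 1, trace (?M z), det (?M z)] \<in> closure pentablock"
        if "z \<in> ball 0 1" for z
        using B(2)[of z] that unfolding closure_pentablock penta_def[symmetric] by simp
    qed (unfold trace_def det_2 sum_2 vector_add_component nth, auto intro!: holomorphic_intros)
    then have "?h constant_on ball 0 1"
    proof (rule maximum_modulus_principle[where U = "ball 0 1" and \<xi> = 0])
      show "norm (?h z) \<le> norm (?h 0)" if "z \<in> ball 0 1" for z
        using max[OF B(2)[of z]] that by simp
    qed auto
    then have const: "?h c = f (penta A)" if "norm c < 1" for c
    proof -
      have "?h c = ?h 0"
        using \<open>?h constant_on ball 0 1\<close> that unfolding constant_on_def by (metis centre_in_ball dist_0_norm mem_ball zero_less_one)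
      then show ?thesis by simp
    qed
    \<comment> \<open>The parameters 1/2 and -1/2 give two maximizers \<open>A + ?X\<close> and
      \<open>A - ?X\<close>, neither longer than \<open>A\<close>; the parallelogram law then forces
      \<open>?X = 0\<close>.\<close>
    let ?X = "mat (1/2) ** B"
    have le: "norm (?M c) \<le> norm A" if "norm c < 1" for c
      using A B(2)[of c] const[OF that] that by (auto simp: T_def)
    have "?M (-1/2) = A - ?X"
      by (simp add: vec_eq_iff nth)
    with le[of "1/2"] le[of "-1/2"] have "norm (A + ?X) \<le> norm A" "norm (A - ?X) \<le> norm A"
      by (simp_all add: norm_divide)
    then have "(norm (A + ?X))\<^sup>2 \<le> (norm A)\<^sup>2" "(norm (A - ?X))\<^sup>2 \<le> (norm A)\<^sup>2"
      by (auto intro: power_mono)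
    then have "(norm ?X)\<^sup>2 \<le> 0"
      by (simp add: power2_norm_eq_inner inner_add inner_diff inner_commute)
    then have "?X = 0" by simp
    then have "B = 0"
      by (simp add: vec_eq_iff nth)
    with B(1) show False ..
  qed
  then show thesis
    using that max by (auto simp: closure_pentablock)
qed

text \<open>A unitary maximizer with unequal diagonal entries has \<open>|a| < \<alpha>\<close>. The
  maximum principle in the first coordinate, with \<open>s\<close> and \<open>p\<close> fixed, moves
  it to \<open>|a| = \<alpha>\<close>.\<close>

lemma domain_algebra_max_on_penta_torus:
  assumes f: "f \<in> domain_algebra pentablock"
  obtains x where "x \<in> penta_torus" "\<And>y. y \<in> closure pentablock \<Longrightarrow> norm (f y) \<le> norm (f x)"
proof -
  obtain U where U: "unitary_matrix U" and max: "\<And>y. y \<in> closure pentablock \<Longrightarrow> norm (f y) \<le> norm (f (penta U))"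
    using domain_algebra_max_at_unitary[OF f] by blast
  define a s p where "a = U $ 2 $ 1" and "s = trace U" and "p = det U"
  have U_cl: "penta U \<in> closure pentablock"
    using unitary_imp_contractive[OF U] by (simp add: closure_pentablock)
  have as: "(norm a)\<^sup>2 + (norm (s / 2))\<^sup>2 \<le> 1"
    using closure_pentablock_bounds(1)[OF U_cl] by (simp add: penta_def a_def s_def)
  have p: "norm p = 1"
    using unitary_matrix_2D(1)[OF U] by (simp add: p_def)
  then have pp: "p * cnj p = 1"
    by (simp flip: complex_norm_square)
  \<comment> \<open>Conjugating \<open>u22 = p * cnj u11\<close> gives
    \<open>u11 = p * cnj u22\<close>; the two are added.\<close>
  have s: "s = cnj s * p"
    using unitary_matrix_2D(3)[OF U] pp unfolding s_def p_def trace_def sum_2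
    by simp algebra
  define \<alpha> where "\<alpha> = sqrt (1 - (norm (s / 2))\<^sup>2)"
  have \<alpha>: "\<alpha> \<ge> 0" "\<alpha>\<^sup>2 = 1 - (norm (s / 2))\<^sup>2"
    using as order_trans[OF _ as, of "(norm (s / 2))\<^sup>2"] by (simp_all add: \<alpha>_def)
  have a\<alpha>: "norm a \<le> \<alpha>"
    by (rule power2_le_imp_le) (use as \<alpha> in linarith)+
  have disc: "vector [c * \<alpha>, s, p] \<in> closure pentablock" if "norm c \<le> 1" for c :: complex
  proof (rule fibre_disc_in_closure[OF p s])
    have "(norm (c * \<alpha>))\<^sup>2 \<le> \<alpha>\<^sup>2"
      using \<alpha>(1) that by (intro power_mono) (simp_all add: norm_mult mult_left_le_one_le)
    then show "(norm (c * \<alpha>))\<^sup>2 + (norm (s / 2))\<^sup>2 \<le> 1"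
      using \<alpha>(2) by simp
  qed
  let ?h = "\<lambda>c :: complex. f (vector [c * \<alpha>, s, p])"
  have hol: "?h holomorphic_on ball 0 1"
    by (rule holomorphic_compose_closure[OF f open_ball])
      (use disc in \<open>auto intro!: holomorphic_intros\<close>)
  have cont: "continuous_on (cball 0 1) ?h"
  proof (rule continuous_on_compose2[of "closure pentablock" f])
    show "continuous_on (closure pentablock) f" using f by (simp add: domain_algebra_def)
  qed (use disc in \<open>auto intro!: continuous_intros\<close>)
  obtain c0 where c0: "norm c0 = 1" "\<And>c. norm c = 1 \<Longrightarrow> norm (?h c) \<le> norm (?h c0)"
  proof -
    have "continuous_on (sphere 0 1) (\<lambda>c. norm (?h c))"
      by (intro continuous_on_norm continuous_on_subset[OF cont]) auto
    moreover have "compact (sphere 0 1 :: complex set)" "(1 :: complex) \<in> sphere 0 1"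
      by auto
    ultimately obtain c0 :: complex where "c0 \<in> sphere 0 1"
        "\<forall>c\<in>sphere 0 1. norm (?h c) \<le> norm (?h c0)"
      using continuous_attains_sup[of "sphere 0 1" "\<lambda>c. norm (?h c)"] by blast
    then show thesis
      by (intro that[of c0]) simp_all
  qed
  \<comment> \<open>If \<open>\<alpha> = 0\<close>, then \<open>a = 0\<close> and
    \<open>a / \<alpha>\<close> is 0 by convention, so this parameter still represents
    \<open>a\<close>.\<close>
  have "norm (?h (a / \<alpha>)) \<le> norm (?h c0)"
  proof (rule maximum_modulus_frontier[of ?h "cball 0 1"])
    show "norm (?h c) \<le> norm (?h c0)" if "c \<in> frontier (cball 0 1)" for c
      using that c0(2)[of c] by simp
    show "a / \<alpha> \<in> cball 0 1"
      using a\<alpha> \<alpha>(1) by (auto simp: norm_divide divide_le_eq_1)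
  qed (use hol cont in simp_all)
  moreover have "a / \<alpha> * \<alpha> = a"
    using a\<alpha> by auto
  ultimately have le: "norm (f (penta U)) \<le> norm (?h c0)"
    by (simp add: penta_def a_def s_def p_def)
  show thesis
  proof (rule that)
    show "vector [c0 * \<alpha>, s, p] \<in> penta_torus"
      using p s \<alpha> c0(1) by (simp add: penta_torus_def norm_mult)
    show "norm (f y) \<le> norm (?h c0)" if "y \<in> closure pentablock" for y
      using max[OF that] le by (rule order_trans)
  qed
qed

text \<open>The torus is a closed boundary, and its points, being peak points, lie in every
  boundary.\<close>

theorem distinguished_boundary_pentablock: "distinguished_boundary pentablock = penta_torus"
  unfolding distinguished_boundary_def
proof (rule Least_equality)
  have "boundary_for pentablock penta_torus"
    unfolding boundary_for_def
    by (meson domain_algebra_max_on_penta_torus penta_torus_subset_closure)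
  then show "closed penta_torus \<and> boundary_for pentablock penta_torus"
    by (simp add: closed_penta_torus)
qed (simp add: penta_torus_subset_boundary)

theorem theorem2p1:
  fixes a s p :: complex
  shows "vector [a, s, p] \<in> distinguished_boundary pentablock \<longleftrightarrow>
    (\<exists>!U :: complex^2^2. unitary_matrix U \<and> U $ 1 $ 1 = U $ 2 $ 2 \<and>
       (a, s, p) = (U $ 2 $ 1, trace U, det U))"
  unfolding distinguished_boundary_pentablock by (rule penta_torus_iff_unique_unitary)

end
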